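(* Let $k\ge1$ be an integer and $n\ge0$. Then \[\sum_F u^{\,n-\mathrm{prop}\,F}\,v^{\,\mathrm{prop}\,F-\mathrm{comp}\,F}\,w^{\,\mathrm{comp}\,F}=P_n\bigl(ku,(k+1)v,w\bigr),\] where the sum is over all $k$-colored ordered forests $F$ on the vertex set $[n]$.
   Context: An ordered tree is a rooted tree in which the children of each vertex are linearly ordered; an ordered forest is a forest of ordered trees in which the trees are also linearly ordered. A $k$-colored ordered forest is an ordered forest whose edges are colored with colors $1,\dots,k$ such that among the children of any vertex, those joined by an edge of color $1$ come first, then those of color $2$, and so on (not every color need appear). A vertex is proper if its label is less than the labels of all its proper descendants; $\mathrm{prop}\,F$ is the number of proper vertices. $\mathrm{comp}\,F$ is the number of left-to-right minima of the sequence of roots of the trees of $F$ (taken in the order of the trees). $P_n(a,b,c)=c\prod_{i=1}^{n-1}(ia+(n-i)b+c)$ for $n\ge1$, and $P_0=1$. *)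

theory Defs
  imports Complex_Main
begin

text \<open>
  A tree with natural-number labels. The list of children records their linear order, and each child
  is paired with the colour of the edge joining it to its parent. A forest is a list of trees, so the
  trees are linearly ordered as well.
\<close>

datatype ctree = Node (label: nat) (children: "(nat \<times> ctree) list")

type_synonym cforest = "ctree list"

fun tree_labels :: "ctree \<Rightarrow> nat list" where
  "tree_labels (Node x cs) = x # concat (map (\<lambda>(c, t). tree_labels t) cs)"

definition forest_labels :: "cforest \<Rightarrow> nat list" where
  "forest_labels F = concat (map tree_labels F)"

text \<open>
  Every subtree \<open>Node x cs\<close> stands for the vertex \<open>x\<close> together with all its descendants.
\<close>

fun subtrees :: "ctree \<Rightarrow> ctree set" where
  "subtrees (Node x cs) = insert (Node x cs) (\<Union>(c, t) \<in> set cs. subtrees t)"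

definition colored_tree :: "nat \<Rightarrow> ctree \<Rightarrow> bool" where
  "colored_tree k T \<longleftrightarrow>
     (\<forall>t \<in> subtrees T. sorted (map fst (children t)) \<and> fst ` set (children t) \<subseteq> {1..k})"

definition colored_forests :: "nat \<Rightarrow> nat \<Rightarrow> cforest set" where
  "colored_forests k n =
     {F. (\<forall>T \<in> set F. colored_tree k T) \<and>
         distinct (forest_labels F) \<and> set (forest_labels F) = {1..n}}"

definition proper_descendants :: "ctree \<Rightarrow> nat set" where
  "proper_descendants t = (\<Union>(c, s) \<in> set (children t). set (tree_labels s))"

definition proper_vertices :: "cforest \<Rightarrow> nat set" where
  "proper_vertices F =
     {label t | t. (\<exists>T \<in> set F. t \<in> subtrees T) \<and> (\<forall>y \<in> proper_descendants t. label t < y)}"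

definition num_prop :: "cforest \<Rightarrow> nat" where
  "num_prop F = card (proper_vertices F)"

definition num_left_to_right_minima :: "nat list \<Rightarrow> nat" where
  "num_left_to_right_minima xs = card {i. i < length xs \<and> (\<forall>j < i. xs ! i < xs ! j)}"

definition num_comp :: "cforest \<Rightarrow> nat" where
  "num_comp F = num_left_to_right_minima (map label F)"

definition P_poly :: "nat \<Rightarrow> 'a::comm_ring_1 \<Rightarrow> 'a \<Rightarrow> 'a \<Rightarrow> 'a" where
  "P_poly n a b c =
     (if n = 0 then 1 else c * (\<Prod>i = 1..n - 1. of_nat i * a + of_nat (n - i) * b + c))"

text \<open>
  For forests in \<open>colored_forests k n\<close> one has \<open>num_comp F \<le> num_prop F \<le> n\<close>, since every leaf is
  proper and so every tree contains a proper vertex. The exponents \<open>n - num_prop F\<close> and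
  \<open>num_prop F - num_comp F\<close> are therefore never truncated. An identity between polynomials in
  \<open>u\<close>, \<open>v\<close>, \<open>w\<close> with integer coefficients is the same as the identity of their values
  in all commutative rings.
\<close>

end

theory Submission imports Defs "HOL-Combinatorics.Multiset_Permutations" begin

text \<open>
  Give a tree the weight \<open>u\<close> per improper vertex and \<open>v\<close> per proper vertex, except that one proper
  vertex counts \<open>1\<close>. For a fixed set of \<open>m\<close> trees, summing
  \<open>v ^ (m - comp) * w ^ comp\<close> over all orderings gives the rising product
  \<open>w (w + v) \<dots> (w + (m - 1) v)\<close>, and the number of ways to arrange the trees as a \<open>k\<close>-coloured list of
  children is \<open>k (k + 1) \<dots> (k + m - 1)\<close>. So lists of children are counted by the forest sum at
  \<open>w = k v\<close>. In a sum over sets of trees, splitting off the tree that contains the smallest label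
  turns the rising product for \<open>w\<close> into \<open>w\<close> times the one for \<open>w + v\<close>. Splitting a tree at its
  root, which is proper iff it is the smallest label, gives the tree sums in terms of
  forest sums. Both recursions are solved by the product formula because of a Hagen--Rothe type
  convolution identity.
\<close>

subsection \<open>The polynomials and their convolutions\<close>

text \<open>The cofactor of \<open>c\<close> in \<open>P_poly (Suc n) a b c\<close>. It gets its own
  name because \<open>c\<close> need not be cancellable in a commutative ring.\<close>

definition Q_poly :: "nat \<Rightarrow> 'a::comm_ring_1 \<Rightarrow> 'a \<Rightarrow> 'a \<Rightarrow> 'a" where
  "Q_poly n a b c = (\<Prod>i = 1..n. of_nat i * a + of_nat (Suc n - i) * b + c)"

lemma P_poly_0 [simp]: "P_poly 0 a b c = 1"
  by (simp add: P_poly_def)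

lemma P_poly_Suc: "P_poly (Suc n) a b c = c * Q_poly n a b c"
  by (simp add: P_poly_def Q_poly_def)

lemma Q_poly_0 [simp]: "Q_poly 0 a b c = 1"
  by (simp add: Q_poly_def)

text \<open>The factor with \<open>i = Suc n\<close> contains \<open>b\<close> exactly once and is
  split off. In every other factor one copy of \<open>b\<close> moves into the constant
  term.\<close>

lemma Q_poly_Suc: "Q_poly (Suc n) a b c = (c + b + of_nat (Suc n) * a) * Q_poly n a b (c + b)"
proof -
  have "(\<Prod>i = 1..n. of_nat i * a + of_nat (Suc (Suc n) - i) * b + c)
      = (\<Prod>i = 1..n. of_nat i * a + of_nat (Suc n - i) * b + (c + b))"
    by (rule prod.cong) (auto simp: Suc_diff_le algebra_simps)
  then show ?thesis
    by (simp add: Q_poly_def algebra_simps)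
qed

text \<open>The coefficients of a product of exponential generating functions.\<close>

definition binomial_conv :: "(nat \<Rightarrow> 'a::comm_ring_1) \<Rightarrow> (nat \<Rightarrow> 'a) \<Rightarrow> nat \<Rightarrow> 'a" where
  "binomial_conv f g n = (\<Sum>j\<le>n. of_nat (n choose j) * f j * g (n - j))"

text \<open>Pascal's rule; in terms of exponential generating functions, the product rule for the
  derivative.\<close>

lemma binomial_conv_Suc:
  "binomial_conv f g (Suc n) = binomial_conv (\<lambda>j. f (Suc j)) g n + binomial_conv f (\<lambda>j. g (Suc j)) n"
proof -
  have "binomial_conv f g (Suc n)
      = f 0 * g (Suc n) + (\<Sum>j\<le>n. of_nat (Suc n choose Suc j) * f (Suc j) * g (n - j))"
    by (simp add: binomial_conv_def sum.atMost_Suc_shift del: sum.atMost_Suc binomial_Suc_Suc)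
  also have "\<dots> = binomial_conv (\<lambda>j. f (Suc j)) g n
      + (f 0 * g (Suc n) + (\<Sum>j\<le>n. of_nat (n choose Suc j) * f (Suc j) * g (n - j)))"
    by (simp add: binomial_conv_def sum.distrib algebra_simps)
  also have "f 0 * g (Suc n) + (\<Sum>j\<le>n. of_nat (n choose Suc j) * f (Suc j) * g (n - j))
      = (\<Sum>j\<le>Suc n. of_nat (n choose j) * f j * g (Suc n - j))"
    by (simp add: sum.atMost_Suc_shift del: sum.atMost_Suc)
  \<comment> \<open>The top term vanishes because \<open>n choose Suc n = 0\<close>.\<close>
  also have "\<dots> = binomial_conv f (\<lambda>j. g (Suc j)) n"
    by (simp add: binomial_conv_def Suc_diff_le binomial_eq_0)
  finally show ?thesis .
qed

text \<open>The factor \<open>j\<close> is absorbed into the binomial coefficient. For generating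
  functions this is multiplication of one factor by the variable.\<close>

lemma binomial_conv_mult_index:
  "binomial_conv (\<lambda>j. of_nat j * f (j - 1)) g (Suc n) = of_nat (Suc n) * binomial_conv f g n"
proof -
  have "binomial_conv (\<lambda>j. of_nat j * f (j - 1)) g (Suc n)
      = (\<Sum>j\<le>n. of_nat (Suc n choose Suc j) * (of_nat (Suc j) * f j) * g (n - j))"
    by (simp add: binomial_conv_def sum.atMost_Suc_shift del: sum.atMost_Suc binomial_Suc_Suc of_nat_Suc)
  also have "\<dots> = (\<Sum>j\<le>n. of_nat (Suc j * (Suc n choose Suc j)) * f j * g (n - j))"
    by (simp only: of_nat_mult mult_ac)
  also have "\<dots> = of_nat (Suc n) * binomial_conv f g n"
    by (simp only: Suc_times_binomial_eq[symmetric] Suc_times_binomial binomial_conv_def sum_distrib_left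
        of_nat_mult mult_ac)
  finally show ?thesis .
qed

lemma binomial_conv_add_left:
  "binomial_conv (\<lambda>j. f j + h j) g n = binomial_conv f g n + binomial_conv h g n"
  by (simp add: binomial_conv_def sum.distrib algebra_simps)

lemma binomial_conv_scale_left:
  "binomial_conv (\<lambda>j. c * f j) g n = c * binomial_conv f g n"
  by (simp add: binomial_conv_def sum_distrib_left mult_ac)

lemma binomial_conv_commute: "binomial_conv f g n = binomial_conv g f n"
proof -
  have "binomial_conv f g n = (\<Sum>j\<le>n. of_nat (n choose (n - j)) * f (n - j) * g (n - (n - j)))"
    unfolding binomial_conv_def by (rule sum.reindex_bij_witness[of _ "\<lambda>j. n - j" "\<lambda>j. n - j"]) auto
  also have "\<dots> = binomial_conv g f n"
    unfolding binomial_conv_def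
    by (rule sum.cong) (auto simp: binomial_symmetric[symmetric] mult_ac)
  finally show ?thesis .
qed

text \<open>The factor \<open>c + b + n a\<close> is cut into \<open>c + b\<close>, which completes
  \<open>Q_poly (n - 1)\<close> to \<open>P_poly n\<close>, and \<open>n a\<close>. For
  \<open>n = 0\<close> the second summand vanishes, so the truncated \<open>n - 1\<close> does no
  harm.\<close>

lemma Q_poly_eq: "Q_poly n a b c = P_poly n a b (c + b) + a * (of_nat n * Q_poly (n - 1) a b (c + b))"
  by (cases n) (simp_all add: P_poly_Suc Q_poly_Suc algebra_simps)

text \<open>The Hagen--Rothe type identity. Both halves are proved in one induction: the product
  rule reduces the first at \<open>Suc n\<close> to the second at \<open>n\<close>, and
  \<open>Q_poly_eq\<close> reduces the second at \<open>Suc n\<close> to the first at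
  \<open>Suc n\<close> and the second at \<open>n\<close>.\<close>

lemma binomial_conv_poly:
  "binomial_conv (\<lambda>j. P_poly j a b c) (\<lambda>j. P_poly j a b d) n = P_poly n a b (c + d) \<and>
   binomial_conv (\<lambda>j. Q_poly j a b c) (\<lambda>j. P_poly j a b d) n = Q_poly n a b (c + d)"
proof (induction n arbitrary: c d)
  case 0
  show ?case by (simp add: binomial_conv_def)
next
  case (Suc n)
  \<comment> \<open>Kept general in \<open>c\<close> and \<open>d\<close>, since the second half
    needs it at \<open>c + b\<close>.\<close>
  have P: "binomial_conv (\<lambda>j. P_poly j a b c) (\<lambda>j. P_poly j a b d) (Suc n) = P_poly (Suc n) a b (c + d)"
    for c d
  proof -
    have "binomial_conv (\<lambda>j. P_poly j a b c) (\<lambda>j. P_poly j a b d) (Suc n)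
      = c * binomial_conv (\<lambda>j. Q_poly j a b c) (\<lambda>j. P_poly j a b d) n
      + d * binomial_conv (\<lambda>j. Q_poly j a b d) (\<lambda>j. P_poly j a b c) n"
      by (simp add: binomial_conv_Suc P_poly_Suc binomial_conv_scale_left
          binomial_conv_commute[of "\<lambda>j. P_poly j a b c" "\<lambda>j. d * Q_poly j a b d"])
    then show ?thesis
      using Suc by (simp add: P_poly_Suc algebra_simps)
  qed
  have "binomial_conv (\<lambda>j. Q_poly j a b c) (\<lambda>j. P_poly j a b d) (Suc n)
      = binomial_conv (\<lambda>j. P_poly j a b (c + b)) (\<lambda>j. P_poly j a b d) (Suc n)
      + a * (of_nat (Suc n) * binomial_conv (\<lambda>j. Q_poly j a b (c + b)) (\<lambda>j. P_poly j a b d) n)"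
    by (subst Q_poly_eq) (simp only: binomial_conv_add_left binomial_conv_scale_left
        binomial_conv_mult_index[of "\<lambda>j. Q_poly j a b (c + b)"])
  also have "\<dots> = Q_poly (Suc n) a b (c + d)"
    using Suc by (subst Q_poly_eq) (simp add: P add_ac del: of_nat_Suc)
  finally show ?case using P by blast
qed

lemma sum_Pow_card:
  fixes g :: "nat \<Rightarrow> 'a::comm_ring_1"
  assumes "finite S"
  shows "(\<Sum>X\<in>Pow S. g (card X)) = (\<Sum>j\<le>card S. of_nat (card S choose j) * g j)"
proof -
  have "(\<Sum>X\<in>Pow S. g (card X)) = (\<Sum>j\<le>card S. \<Sum>X\<in>{X\<in>Pow S. card X = j}. g (card X))"
    using assms by (intro sum.group[symmetric]) (auto intro: card_mono)
  also have "\<dots> = (\<Sum>j\<le>card S. of_nat (card S choose j) * g j)"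
    using assms by (intro sum.cong) (simp_all add: n_subsets)
  finally show ?thesis .
qed

subsection \<open>Orderings and coloured orderings of a finite set\<close>

definition rising :: "'a::comm_ring_1 \<Rightarrow> 'a \<Rightarrow> nat \<Rightarrow> 'a" where
  "rising v w m = (\<Prod>i<m. w + of_nat i * v)"

lemma rising_0 [simp]: "rising v w 0 = 1"
  by (simp add: rising_def)

lemma rising_Suc: "rising v w (Suc m) = rising v w m * (w + of_nat m * v)"
  by (simp add: rising_def)

lemma rising_Suc_shift: "rising v w (Suc m) = w * rising v (w + v) m"
  by (simp add: rising_def prod.lessThan_Suc_shift algebra_simps del: prod.lessThan_Suc)

text \<open>At \<open>c = of_nat k\<close> the right side is \<open>v ^ m\<close> times the number
  of coloured child lists formed from \<open>m\<close> trees. This is what links lists of children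
  to the forest sum at \<open>w = k v\<close>.\<close>

lemma rising_scale: "rising v (c * v) m = v ^ m * rising 1 c m"
  by (induction m) (simp_all add: rising_Suc algebra_simps)


section \<open>Left-to-right minima over all orderings of a set\<close>

lemma num_left_to_right_minima_snoc:
  "num_left_to_right_minima (xs @ [x]) =
   num_left_to_right_minima xs + (if \<forall>y\<in>set xs. x < y then 1 else 0)"
proof -
  let ?M = "\<lambda>xs. {i. i < length xs \<and> (\<forall>j < i. xs ! i < xs ! j)}"
  have "?M (xs @ [x]) = ?M xs \<union> (if \<forall>y\<in>set xs. x < y then {length xs} else {})"
    by (auto simp: nth_append less_Suc_eq all_set_conv_all_nth)
  then show ?thesis
    by (simp add: num_left_to_right_minima_def)
qed

lemma num_left_to_right_minima_le: "num_left_to_right_minima xs \<le> length xs"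
  by (induction xs rule: rev_induct) (simp_all add: num_left_to_right_minima_snoc, simp add: num_left_to_right_minima_def)

text \<open>The last entry is a left-to-right minimum iff it is the smallest of all. So among the
  \<open>m + 1\<close> choices for it one contributes \<open>w\<close> and the others
  \<open>v\<close>, whatever the order of the rest, which gives the factor
  \<open>w + m v\<close>.\<close>

lemma sum_permutations_left_to_right_minima:
  fixes v w :: "'a::comm_ring_1" and f :: "'b \<Rightarrow> nat"
  assumes "finite A" "inj_on f A"
  shows "(\<Sum>xs\<in>permutations_of_set A. v ^ (card A - num_left_to_right_minima (map f xs))
            * w ^ num_left_to_right_minima (map f xs)) = rising v w (card A)"
  using assms
proof (induction "card A" arbitrary: A)
  case 0
  then show ?case by (simp add: num_left_to_right_minima_def)
next
  case (Suc m)
  let ?l = "\<lambda>xs. num_left_to_right_minima (map f xs)"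
  let ?W = "\<lambda>m xs. v ^ (m - ?l xs) * w ^ ?l xs"
  have ne: "A \<noteq> {}" using Suc by auto
  define z where "z = arg_min_on f A"
  have z: "z \<in> A" "\<And>y. y \<in> A \<Longrightarrow> f z \<le> f y"
    using Suc(3) ne arg_min_if_finite(1)[of A f] arg_min_least[of A _ f] unfolding z_def by auto
  \<comment> \<open>\<open>permutations_of_set_nonempty\<close> splits off the first entry; reversal
    turns it into the last one.\<close>
  have rev_sum: "(\<Sum>xs\<in>permutations_of_set B. g xs) = (\<Sum>xs\<in>permutations_of_set B. g (rev xs))"
    for B :: "'b set" and g :: "_ \<Rightarrow> 'a"
    by (rule sum.reindex_bij_witness[of _ rev rev]) (auto simp: permutations_of_set_def)
  have step: "?W (Suc m) (xs @ [x]) = (if x = z then w else v) * ?W m xs"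
    if "x \<in> A" "xs \<in> permutations_of_set (A - {x})" for x xs
  proof -
    have s: "set xs = A - {x}" "distinct xs"
      using that by (auto simp: permutations_of_set_def)
    then have len: "length xs = m"
      using Suc(2,3) that(1) distinct_card[of xs] by simp
    have iff: "(\<forall>y\<in>f ` set xs. f x < y) \<longleftrightarrow> x = z"
    proof
      assume *: "\<forall>y\<in>f ` set xs. f x < y"
      show "x = z"
      proof (rule ccontr)
        assume "x \<noteq> z"
        then have "f x < f z" using * z s by auto
        then show False using z(2)[OF that(1)] by simp
      qed
    next
      assume "x = z"
      then show "\<forall>y\<in>f ` set xs. f x < y"
        using z s Suc(4) by (auto simp: le_less dest: inj_onD)
    qed
    have "?l xs \<le> m" using num_left_to_right_minima_le[of "map f xs"] len by simp
    then show ?thesis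
      using iff by (simp add: num_left_to_right_minima_snoc Suc_diff_le mult_ac)
  qed
  have "(\<Sum>xs\<in>permutations_of_set A. ?W (Suc m) xs)
      = (\<Sum>xs\<in>(\<Union>x\<in>A. (#) x ` permutations_of_set (A - {x})). ?W (Suc m) (rev xs))"
    by (subst rev_sum) (simp add: permutations_of_set_nonempty[OF ne])
  also have "\<dots> = (\<Sum>x\<in>A. \<Sum>xs\<in>(#) x ` permutations_of_set (A - {x}). ?W (Suc m) (rev xs))"
    using Suc(3) by (subst sum.UNION_disjoint) auto
  also have "\<dots> = (\<Sum>x\<in>A. \<Sum>xs\<in>permutations_of_set (A - {x}). ?W (Suc m) (rev xs @ [x]))"
    by (simp add: sum.reindex)
  also have "\<dots> = (\<Sum>x\<in>A. \<Sum>xs\<in>permutations_of_set (A - {x}). ?W (Suc m) (xs @ [x]))"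
    by (simp only: rev_sum[of "\<lambda>xs. ?W (Suc m) (xs @ [_])"])
  also have "\<dots> = (\<Sum>x\<in>A. \<Sum>xs\<in>permutations_of_set (A - {x}). (if x = z then w else v) * ?W m xs)"
    using step by (intro sum.cong) auto
  also have "\<dots> = (\<Sum>x\<in>A. (if x = z then w else v) * rising v w m)"
  proof (intro sum.cong refl)
    fix x assume x: "x \<in> A"
    then have c: "m = card (A - {x})" using Suc(2,3) by simp
    show "(\<Sum>xs\<in>permutations_of_set (A - {x}). (if x = z then w else v) * ?W m xs)
        = (if x = z then w else v) * rising v w m"
      using Suc(1)[OF c] Suc(3,4) c by (simp add: sum_distrib_left[symmetric] inj_on_diff)
  qed
  also have "\<dots> = rising v w (Suc m)"
  proof -
    have "(\<Sum>x\<in>A. if x = z then w else v) = w + (\<Sum>x\<in>A - {z}. v)"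
      using Suc(3) z by (subst sum.remove[of A z]) auto
    also have "\<dots> = w + of_nat m * v"
      using Suc(2)[symmetric] z by simp
    finally show ?thesis
      unfolding sum_distrib_right[symmetric] rising_Suc by (simp only: mult.commute)
  qed
  finally show ?case using Suc(2) by simp
qed

section \<open>Counting coloured lists of children\<close>

text \<open>Lists of children are the case \<open>l = 1\<close>. The lower bound \<open>l\<close> is
  a parameter to allow recursion on the number of available colours.\<close>

definition color_orderings :: "nat \<Rightarrow> nat \<Rightarrow> 'b set \<Rightarrow> (nat \<times> 'b) list set" where
  "color_orderings l k A =
     {cs. sorted (map fst cs) \<and> fst ` set cs \<subseteq> {l..k} \<and> distinct (map snd cs) \<and> snd ` set cs = A}"

lemma color_orderings_empty [simp]: "color_orderings l k {} = {[]}"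
  by (auto simp: color_orderings_def)

lemma finite_color_orderings:
  assumes "finite A"
  shows "finite (color_orderings l k A)"
proof (rule finite_subset)
  show "color_orderings l k A \<subseteq> {cs. set cs \<subseteq> {l..k} \<times> A \<and> length cs \<le> card A}"
  proof safe
    fix cs assume "cs \<in> color_orderings l k A"
    then have cs: "fst ` set cs \<subseteq> {l..k}" "snd ` set cs = A" "distinct (map snd cs)"
      by (auto simp: color_orderings_def)
    then show "length cs \<le> card A"
      using distinct_card[of "map snd cs"] by simp
    fix c x assume "(c, x) \<in> set cs"
    then show "c \<in> {l..k}" "x \<in> A" using cs by force+
  qed
  show "finite {cs. set cs \<subseteq> {l..k} \<times> A \<and> length cs \<le> card A}"
    using assms by (intro finite_lists_length_le) auto
qed

text \<open>Since colours increase along the list, either colour \<open>l\<close> does not occur or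
  the first entry has colour \<open>l\<close>; in the latter case colour \<open>l\<close> stays
  available for the rest.\<close>

lemma color_orderings_rec:
  assumes "l \<le> k" "A \<noteq> {}"
  shows "color_orderings l k A =
    color_orderings (Suc l) k A \<union> (\<Union>x\<in>A. (#) (l, x) ` color_orderings l k (A - {x}))"
    (is "?L = ?R")
proof
  show "?L \<subseteq> ?R"
  proof
    fix cs assume cs: "cs \<in> ?L"
    then obtain c x ds where cs_eq: "cs = (c, x) # ds"
      using assms(2) by (cases cs) (auto simp: color_orderings_def)
    show "cs \<in> ?R"
    proof (cases "c = l")
      case True
      then have "ds \<in> color_orderings l k (A - {x})" "x \<in> A"
        using cs cs_eq by (force simp: color_orderings_def)+
      then show ?thesis using True cs_eq by auto
    next
      case False
      then have "cs \<in> color_orderings (Suc l) k A"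
        using cs cs_eq by (fastforce simp: color_orderings_def)
      then show ?thesis by auto
    qed
  qed
  show "?R \<subseteq> ?L"
    using assms(1) by (fastforce simp: color_orderings_def)
qed

text \<open>Outer induction on the number of colours, inner induction on \<open>card A\<close>. With
  \<open>d + 1\<close> colours and \<open>m + 1\<close> elements the two parts of the recursion have
  \<open>d\<close> and \<open>m + 1\<close> times \<open>(d + 1) \<dots> (d + m)\<close> members, so
  together \<open>d + m + 1\<close> times that product.\<close>

lemma card_color_orderings:
  assumes "finite A" "l \<le> Suc k"
  shows "card (color_orderings l k A) = (\<Prod>i<card A. Suc k - l + i)"
  using assms
proof (induction "Suc k - l" arbitrary: l A)
  case 0
  then have "l = Suc k" by simp
  then have "color_orderings l k A = (if A = {} then {[]} else {})"
    by (auto simp: color_orderings_def)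
  then show ?case using 0 \<open>l = Suc k\<close> by (auto simp: card_gt_0_iff)
next
  case (Suc d)
  note IH = Suc(1) and d = Suc(2)
  show ?case using Suc(3)
  proof (induction "card A" arbitrary: A)
    case 0
    then show ?case by simp
  next
    case (Suc m)
    have lk: "l \<le> k" using d by simp
    have ne: "A \<noteq> {}" using Suc by auto
    let ?f = "\<lambda>x. (#) (l, x) ` color_orderings l k (A - {x})"
    have "card (color_orderings l k A)
        = card (color_orderings (Suc l) k A) + card (\<Union>x\<in>A. ?f x)"
      unfolding color_orderings_rec[OF lk ne] using Suc(3)
      by (intro card_Un_disjoint) (auto simp: finite_color_orderings, auto simp: color_orderings_def)
    also have "card (\<Union>x\<in>A. ?f x) = (\<Sum>x\<in>A. card (?f x))"
      using Suc(3) by (intro card_UN_disjoint) (auto simp: finite_color_orderings)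
    also have "\<dots> = (\<Sum>x\<in>A. \<Prod>i<m. Suc k - l + i)"
    proof (intro sum.cong refl)
      fix x assume "x \<in> A"
      then have "m = card (A - {x})" using Suc(2,3) by simp
      then show "card (?f x) = (\<Prod>i<m. Suc k - l + i)"
        using Suc(1)[of "A - {x}"] Suc(3) by (simp add: card_image)
    qed
    also have "card (color_orderings (Suc l) k A) = (\<Prod>i<Suc m. d + i)"
      using IH[of "Suc l" A] d Suc(2,3) lk by (simp add: Suc_diff_le)
    also have "(\<Prod>i<Suc m. d + i) = d * (\<Prod>i<m. Suc k - l + i)"
      unfolding d[symmetric] by (simp add: prod.lessThan_Suc_shift del: prod.lessThan_Suc)
    finally have "card (color_orderings l k A) = (d + Suc m) * (\<Prod>i<m. Suc k - l + i)"
      using Suc(2) by (simp add: algebra_simps)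
    also have "d + Suc m = Suc k - l + m" using d by simp
    finally show ?case unfolding Suc(2)[symmetric] by (simp only: prod.lessThan_Suc mult.commute)
  qed
qed

subsection \<open>Trees and sets of trees with prescribed labels\<close>

definition labeled_trees :: "nat \<Rightarrow> nat set \<Rightarrow> ctree set" where
  "labeled_trees k S = {T. colored_tree k T \<and> distinct (tree_labels T) \<and> set (tree_labels T) = S}"

text \<open>Unordered forests on the label set \<open>S\<close>. The order is put back by
  \<open>permutations_of_set\<close> for the trees of a forest and by \<open>color_orderings\<close>
  for the children of a vertex.\<close>

definition tree_sets :: "nat \<Rightarrow> nat set \<Rightarrow> ctree set set" where
  "tree_sets k S =
     {A. finite A \<and> (\<forall>T\<in>A. colored_tree k T \<and> distinct (tree_labels T)) \<and>
         (\<forall>T\<in>A. \<forall>T'\<in>A. T \<noteq> T' \<longrightarrow> set (tree_labels T) \<inter> set (tree_labels T') = {}) \<and>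
         (\<Union>T\<in>A. set (tree_labels T)) = S}"

lemma tree_sets_labels_subset: "A \<in> tree_sets k S \<Longrightarrow> T \<in> A \<Longrightarrow> set (tree_labels T) \<subseteq> S"
  by (auto simp: tree_sets_def)

lemma label_in_tree_labels: "label T \<in> set (tree_labels T)"
  by (cases T) simp

lemma tree_labels_ne [simp]: "tree_labels T \<noteq> []"
  by (cases T) simp

lemma set_forest_labels: "set (forest_labels F) = (\<Union>T\<in>set F. set (tree_labels T))"
  by (simp add: forest_labels_def)

text \<open>A tree has at least one label, so a tree listed twice would repeat a label; hence the
  conjunct \<open>distinct F\<close>.\<close>

lemma distinct_forest_labels:
  "distinct (forest_labels F) \<longleftrightarrow> distinct F \<and> (\<forall>T\<in>set F. distinct (tree_labels T)) \<and>
     (\<forall>T\<in>set F. \<forall>T'\<in>set F. T \<noteq> T' \<longrightarrow> set (tree_labels T) \<inter> set (tree_labels T') = {})"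
proof -
  define d where "d T T' \<longleftrightarrow> set (tree_labels T) \<inter> set (tree_labels T') = {}" for T T'
  have sym: "d T T' \<longleftrightarrow> d T' T" for T T'
    by (auto simp: d_def)
  have irrefl: "\<not> d T T" for T
    using label_in_tree_labels[of T] by (auto simp: d_def)
  have "distinct (forest_labels F) \<longleftrightarrow> distinct F \<and> (\<forall>T\<in>set F. distinct (tree_labels T)) \<and>
     (\<forall>T\<in>set F. \<forall>T'\<in>set F. T \<noteq> T' \<longrightarrow> d T T')"
  proof (induction F)
    case Nil
    show ?case by (simp add: forest_labels_def)
  next
    case (Cons T F)
    have pair: "(\<forall>U\<in>set (T # F). \<forall>T'\<in>set (T # F). U \<noteq> T' \<longrightarrow> d U T') \<longleftrightarrow>
        (\<forall>T'\<in>set F. T \<noteq> T' \<longrightarrow> d T T') \<and> (\<forall>U\<in>set F. \<forall>T'\<in>set F. U \<noteq> T' \<longrightarrow> d U T')"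
      (is "?L \<longleftrightarrow> ?R")
    proof
      assume ?R
      show ?L
      proof (intro ballI impI)
        fix U T' assume "U \<in> set (T # F)" "T' \<in> set (T # F)" "U \<noteq> T'"
        then show "d U T'"
          using \<open>?R\<close> sym[of U T'] by (cases "U = T"; cases "T' = T") simp_all
      qed
    qed simp
    have new: "(\<forall>T'\<in>set F. d T T') \<longleftrightarrow> T \<notin> set F \<and> (\<forall>T'\<in>set F. T \<noteq> T' \<longrightarrow> d T T')"
      using irrefl by metis
    have "distinct (forest_labels (T # F)) \<longleftrightarrow>
        distinct (tree_labels T) \<and> distinct (forest_labels F) \<and> (\<forall>T'\<in>set F. d T T')"
      by (auto simp: forest_labels_def d_def)
    also have "\<dots> \<longleftrightarrow> distinct (T # F) \<and> (\<forall>T\<in>set (T # F). distinct (tree_labels T)) \<and>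
        (\<forall>U\<in>set (T # F). \<forall>T'\<in>set (T # F). U \<noteq> T' \<longrightarrow> d U T')"
      unfolding Cons pair new unfolding list.set ball_simps distinct.simps by argo
    finally show ?case .
  qed
  then show ?thesis unfolding d_def .
qed

lemma forests_eq_orderings:
  "{F. (\<forall>T\<in>set F. colored_tree k T) \<and> distinct (forest_labels F) \<and> set (forest_labels F) = S}
     = (\<Union>A\<in>tree_sets k S. permutations_of_set A)"
  by (auto simp: distinct_forest_labels set_forest_labels tree_sets_def permutations_of_set_def)

lemma colored_tree_Node:
  "colored_tree k (Node r cs) \<longleftrightarrow>
     sorted (map fst cs) \<and> fst ` set cs \<subseteq> {1..k} \<and> (\<forall>T\<in>snd ` set cs. colored_tree k T)"
proof -
  have "subtrees (Node r cs) = insert (Node r cs) (\<Union>T\<in>snd ` set cs. subtrees T)"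
    by auto
  then show ?thesis
    unfolding colored_tree_def by (simp del: subtrees.simps add: ball_UN)
qed

lemma tree_labels_Node: "tree_labels (Node r cs) = r # forest_labels (map snd cs)"
  by (simp add: forest_labels_def comp_def case_prod_unfold)

text \<open>A tree is cut at its root \<open>r\<close>: its children form an unordered forest on the
  remaining labels, together with a coloured ordering of that forest.\<close>

lemma labeled_trees_eq:
  "labeled_trees k S =
     (\<Union>r\<in>S. \<Union>A\<in>tree_sets k (S - {r}). Node r ` color_orderings 1 k A)"
proof (intro equalityI subsetI)
  fix T assume T: "T \<in> labeled_trees k S"
  obtain r cs where eq: "T = Node r cs" by (cases T)
  have S: "S = insert r (set (forest_labels (map snd cs)))" "r \<notin> set (forest_labels (map snd cs))"
    using T eq by (auto simp: labeled_trees_def tree_labels_Node simp del: tree_labels.simps)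
  have d: "distinct (forest_labels (map snd cs))"
    using T eq by (auto simp: labeled_trees_def tree_labels_Node simp del: tree_labels.simps)
  have c: "colored_tree k (Node r cs)" using T eq by (simp add: labeled_trees_def)
  have "r \<in> S" "S - {r} = set (forest_labels (map snd cs))" using S by auto
  moreover have "snd ` set cs \<in> tree_sets k (set (forest_labels (map snd cs)))"
    using d c unfolding distinct_forest_labels set_forest_labels tree_sets_def colored_tree_Node by simp
  moreover have "cs \<in> color_orderings 1 k (snd ` set cs)"
    using c d by (simp add: color_orderings_def colored_tree_Node distinct_forest_labels)
  ultimately show "T \<in> (\<Union>r\<in>S. \<Union>A\<in>tree_sets k (S - {r}). Node r ` color_orderings 1 k A)"
    unfolding eq by (intro UN_I[of r] UN_I[of "snd ` set cs"] imageI) simp_all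
next
  fix T assume "T \<in> (\<Union>r\<in>S. \<Union>A\<in>tree_sets k (S - {r}). Node r ` color_orderings 1 k A)"
  then obtain r A cs where *: "r \<in> S" "A \<in> tree_sets k (S - {r})" "cs \<in> color_orderings 1 k A"
    and eq: "T = Node r cs" by auto
  have A: "set (map snd cs) = A" using *(3) by (simp add: color_orderings_def)
  have "distinct (forest_labels (map snd cs))" "set (forest_labels (map snd cs)) = S - {r}"
    using *(2,3) unfolding distinct_forest_labels set_forest_labels A
    by (auto simp: tree_sets_def color_orderings_def)
  moreover have "colored_tree k T"
    using * unfolding eq colored_tree_Node by (auto simp: tree_sets_def color_orderings_def)
  ultimately show "T \<in> labeled_trees k S"
    using *(1) by (auto simp: eq labeled_trees_def tree_labels_Node simp del: tree_labels.simps)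
qed

text \<open>A crude bound that serves only to prove finiteness.\<close>

lemma tree_sets_subset: "tree_sets k S \<subseteq> Pow (\<Union>X\<in>Pow S. labeled_trees k X)"
  by (fastforce simp: tree_sets_def labeled_trees_def)

lemma finite_labeled_trees: "finite S \<Longrightarrow> finite (labeled_trees k S)"
proof (induction S rule: finite_psubset_induct)
  case (psubset S)
  have "finite (tree_sets k (S - {r}))" if "r \<in> S" for r
  proof (rule finite_subset[OF tree_sets_subset])
    have "finite (labeled_trees k X)" if "X \<in> Pow (S - {r})" for X
      using that \<open>r \<in> S\<close> by (intro psubset) auto
    then show "finite (Pow (\<Union>X\<in>Pow (S - {r}). labeled_trees k X))"
      using psubset(1) by simp
  qed
  then show ?case
    using psubset(1) unfolding labeled_trees_eq[of k S]
    by (auto intro!: finite_color_orderings simp: tree_sets_def)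
qed

lemma finite_tree_sets: "finite S \<Longrightarrow> finite (tree_sets k S)"
  by (rule finite_subset[OF tree_sets_subset]) (auto intro: finite_labeled_trees finite_subset)

section \<open>Proper vertices and weights\<close>

lemma label_subtree: "t \<in> subtrees T \<Longrightarrow> label t \<in> set (tree_labels T)"
  by (induction T rule: subtrees.induct) fastforce

lemma proper_vertices_eq_UN: "proper_vertices F = (\<Union>T\<in>set F. proper_vertices [T])"
  by (auto simp: proper_vertices_def)

lemma proper_vertices_subset: "proper_vertices [T] \<subseteq> set (tree_labels T)"
  by (auto simp: proper_vertices_def label_subtree)

lemma finite_proper_vertices: "finite (proper_vertices F)"
  unfolding proper_vertices_eq_UN[of F] using finite_subset[OF proper_vertices_subset] by blast

text \<open>Whether a vertex is proper depends only on the subtree below it, so cutting off the root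
  affects no other vertex.\<close>

lemma proper_vertices_Node:
  "proper_vertices [Node r cs] =
     (if \<forall>y\<in>set (forest_labels (map snd cs)). r < y then {r} else {}) \<union> proper_vertices (map snd cs)"
proof -
  have "proper_descendants (Node r cs) = set (forest_labels (map snd cs))"
    by (auto simp: proper_descendants_def forest_labels_def)
  moreover have "subtrees (Node r cs) = insert (Node r cs) (\<Union>T\<in>set (map snd cs). subtrees T)"
    by auto
  ultimately show ?thesis
    unfolding proper_vertices_def by (auto simp del: subtrees.simps intro: exI[of _ "Node r cs"])
qed

text \<open>Descending through first children ends at a leaf, and leaves are proper. Hence
  \<open>num_prop [T] - 1\<close> in \<open>tree_weight\<close> is never truncated.\<close>

lemma num_prop_pos: "0 < num_prop [T]"
proof -
  have "proper_vertices [T] \<noteq> {}"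
  proof (induction T)
    case (Node r cs)
    show ?case
    proof (cases cs)
      case Nil
      then show ?thesis by (simp add: proper_vertices_Node forest_labels_def)
    next
      case (Cons ct cs')
      then have "proper_vertices [snd ct] \<noteq> {}"
        by (intro Node[of ct]) (simp_all add: prod_set_defs)
      moreover have "proper_vertices [snd ct] \<subseteq> proper_vertices (map snd cs)"
        unfolding proper_vertices_eq_UN[of "map snd cs"] using Cons by auto
      ultimately show ?thesis by (auto simp: proper_vertices_Node)
    qed
  qed
  then show ?thesis
    by (simp add: num_prop_def card_gt_0_iff finite_proper_vertices)
qed

lemma num_prop_le: "distinct (tree_labels T) \<Longrightarrow> num_prop [T] \<le> length (tree_labels T)"
  unfolding num_prop_def
  using card_mono[OF _ proper_vertices_subset[of T]] distinct_card[of "tree_labels T"] by simp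

lemma num_prop_eq_sum:
  assumes "A \<in> tree_sets k S" "set F = A"
  shows "num_prop F = (\<Sum>T\<in>A. num_prop [T])"
  unfolding num_prop_def proper_vertices_eq_UN[of F] assms(2)
proof (rule card_UN_disjoint)
  show "finite A" using assms(1) by (simp add: tree_sets_def)
  show "\<forall>T\<in>A. finite (proper_vertices [T])" by (simp add: finite_proper_vertices)
  show "\<forall>T\<in>A. \<forall>T'\<in>A. T \<noteq> T' \<longrightarrow> proper_vertices [T] \<inter> proper_vertices [T'] = {}"
  proof (intro ballI impI)
    fix T T' assume "T \<in> A" "T' \<in> A" "T \<noteq> T'"
    then have "set (tree_labels T) \<inter> set (tree_labels T') = {}"
      using assms(1) unfolding tree_sets_def by simp
    then show "proper_vertices [T] \<inter> proper_vertices [T'] = {}"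
      using proper_vertices_subset[of T] proper_vertices_subset[of T'] by blast
  qed
qed

lemma card_eq_sum_length:
  assumes "A \<in> tree_sets k S"
  shows "card S = (\<Sum>T\<in>A. length (tree_labels T))"
proof -
  have "card S = card (\<Union>T\<in>A. set (tree_labels T))"
    using assms by (simp add: tree_sets_def)
  also have "\<dots> = (\<Sum>T\<in>A. card (set (tree_labels T)))"
    using assms by (intro card_UN_disjoint) (auto simp: tree_sets_def)
  also have "\<dots> = (\<Sum>T\<in>A. length (tree_labels T))"
    using assms by (intro sum.cong) (auto simp: tree_sets_def distinct_card)
  finally show ?thesis .
qed

text \<open>The exponent of \<open>v\<close> is lowered by one because the missing factor is supplied, as \<open>v\<close> or \<open>w\<close>, by the
  position of the tree in the forest.\<close>
definition tree_weight :: "'a::comm_ring_1 \<Rightarrow> 'a \<Rightarrow> ctree \<Rightarrow> 'a" where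
  "tree_weight u v T = u ^ (length (tree_labels T) - num_prop [T]) * v ^ (num_prop [T] - 1)"

text \<open>Exponents add up over the trees, and no subtraction truncates because
  \<open>1 \<le> num_prop [T] \<le> length (tree_labels T)\<close>. Each tree leaves one proper
  vertex uncounted, hence \<open>num_prop F - card A\<close>.\<close>

lemma prod_tree_weight:
  assumes "A \<in> tree_sets k S" "set F = A"
  shows "(\<Prod>T\<in>A. tree_weight u v T) = u ^ (card S - num_prop F) * v ^ (num_prop F - card A)"
    and "card A \<le> num_prop F" and "num_prop F \<le> card S"
proof -
  have le: "num_prop [T] \<le> length (tree_labels T)" if "T \<in> A" for T
    using assms that by (intro num_prop_le) (auto simp: tree_sets_def)
  have "(\<Sum>T\<in>A. length (tree_labels T) - num_prop [T]) = card S - num_prop F"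
    using le by (simp add: sum_subtractf_nat num_prop_eq_sum[OF assms] card_eq_sum_length[OF assms(1)])
  moreover have "(\<Sum>T\<in>A. num_prop [T] - 1) = num_prop F - card A"
    using num_prop_pos by (subst sum_subtractf_nat) (auto simp: num_prop_eq_sum[OF assms] Suc_le_eq)
  moreover have "(\<Prod>T\<in>A. tree_weight u v T) =
      u ^ (\<Sum>T\<in>A. length (tree_labels T) - num_prop [T]) * v ^ (\<Sum>T\<in>A. num_prop [T] - 1)"
    unfolding tree_weight_def prod.distrib power_sum ..
  ultimately show "(\<Prod>T\<in>A. tree_weight u v T) = u ^ (card S - num_prop F) * v ^ (num_prop F - card A)"
    by simp
  show "num_prop F \<le> card S"
    using le by (simp add: num_prop_eq_sum[OF assms] card_eq_sum_length[OF assms(1)] sum_mono)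
  show "card A \<le> num_prop F"
    using num_prop_pos sum_mono[of A "\<lambda>_. 1" "\<lambda>T. num_prop [T]"]
    by (simp add: num_prop_eq_sum[OF assms] Suc_le_eq)
qed

lemma inj_on_label:
  assumes "A \<in> tree_sets k S"
  shows "inj_on label A"
proof (rule inj_onI)
  fix T T' assume T: "T \<in> A" "T' \<in> A" and eq: "label T = label T'"
  show "T = T'"
  proof (rule ccontr)
    assume "T \<noteq> T'"
    then have "set (tree_labels T) \<inter> set (tree_labels T') = {}"
      using assms T unfolding tree_sets_def by simp
    then show False
      using label_in_tree_labels[of T] label_in_tree_labels[of T'] eq by auto
  qed
qed

subsection \<open>Weighted sums over trees and forests\<close>

text \<open>The factor \<open>rising v w (card A)\<close> stands for the sum over all orderings of
  \<open>A\<close>, so only unordered forests remain to be summed.\<close>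

definition forest_sum :: "nat \<Rightarrow> 'a::comm_ring_1 \<Rightarrow> 'a \<Rightarrow> 'a \<Rightarrow> nat set \<Rightarrow> 'a" where
  "forest_sum k u v w S = (\<Sum>A\<in>tree_sets k S. (\<Prod>T\<in>A. tree_weight u v T) * rising v w (card A))"

lemma sum_colored_forests:
  "(\<Sum>F \<in> colored_forests k n.
      u ^ (n - num_prop F) * v ^ (num_prop F - num_comp F) * w ^ num_comp F)
   = forest_sum k u v w {1..n}" (is "sum ?W _ = _")
proof -
  let ?S = "{1..n}"
  have W: "?W F = (\<Prod>T\<in>A. tree_weight u v T) * (v ^ (card A - num_comp F) * w ^ num_comp F)"
    if "A \<in> tree_sets k ?S" "F \<in> permutations_of_set A" for A F
  proof -
    have F: "set F = A" "distinct F" using that(2) by (auto simp: permutations_of_set_def)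
    have "num_comp F \<le> card A"
      using num_left_to_right_minima_le[of "map label F"] distinct_card[OF F(2)] F(1)
      by (simp add: num_comp_def)
    \<comment> \<open>The first summand belongs to the weights of the trees, the second to their
      ordering.\<close>
    then have "num_prop F - num_comp F = (num_prop F - card A) + (card A - num_comp F)"
      using prod_tree_weight(2)[OF that(1) F(1)] by simp
    then show ?thesis
      using prod_tree_weight(1)[OF that(1) F(1), of u v] by (simp add: power_add mult_ac)
  qed
  have "sum ?W (colored_forests k n) = sum ?W (\<Union>A\<in>tree_sets k ?S. permutations_of_set A)"
    by (simp only: colored_forests_def forests_eq_orderings)
  also have "\<dots> = (\<Sum>A\<in>tree_sets k ?S. \<Sum>F\<in>permutations_of_set A. ?W F)"
    by (intro sum.UNION_disjoint) (simp_all add: finite_tree_sets, auto simp: permutations_of_set_def)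
  also have "\<dots> = (\<Sum>A\<in>tree_sets k ?S. (\<Prod>T\<in>A. tree_weight u v T) *
      (\<Sum>F\<in>permutations_of_set A. v ^ (card A - num_comp F) * w ^ num_comp F))"
    unfolding sum_distrib_left using W by (intro sum.cong refl) auto
  also have "\<dots> = forest_sum k u v w ?S"
    unfolding forest_sum_def num_comp_def
    by (intro sum.cong refl, subst sum_permutations_left_to_right_minima)
       (auto simp: inj_on_label, simp add: tree_sets_def)
  finally show ?thesis .
qed

text \<open>The children's weights omit one factor \<open>v\<close> for each of the
  \<open>card A\<close> trees. A root \<open>Min S\<close> is proper and serves as the new uncounted
  vertex, so all of these factors return. Any other root is improper and contributes
  \<open>u\<close>, while one factor stays omitted.\<close>

lemma tree_weight_Node:
  assumes "finite S" "r \<in> S" and A: "A \<in> tree_sets k (S - {r})" and cs: "cs \<in> color_orderings 1 k A"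
  shows "tree_weight u v (Node r cs) =
    (if r = Min S then v ^ card A else u * v ^ (card A - 1)) * (\<Prod>T\<in>A. tree_weight u v T)"
proof -
  let ?F = "map snd cs"
  have F: "set ?F = A" "distinct ?F" using cs by (auto simp: color_orderings_def)
  have fl: "set (forest_labels ?F) = S - {r}"
    using A unfolding set_forest_labels F by (simp add: tree_sets_def)
  have "distinct (forest_labels ?F)"
    using A F unfolding distinct_forest_labels F by (simp add: tree_sets_def)
  then have len: "length (tree_labels (Node r cs)) = Suc (card (S - {r}))"
    unfolding tree_labels_Node fl[symmetric] by (simp add: distinct_card)
  have nin: "r \<notin> proper_vertices ?F"
    using proper_vertices_subset fl[unfolded set_forest_labels]
    unfolding proper_vertices_eq_UN[of ?F] by fastforce
  have "(\<forall>y\<in>S - {r}. r < y) \<longleftrightarrow> r = Min S"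
  proof
    assume "\<forall>y\<in>S - {r}. r < y"
    then have "r \<le> y" if "y \<in> S" for y using that by (cases "y = r") (auto intro: less_imp_le)
    then show "r = Min S" using assms(1,2) by (intro Min_eqI[symmetric])
  next
    assume "r = Min S"
    then have "r \<le> y" if "y \<in> S" for y using that assms(1) by simp
    then show "\<forall>y\<in>S - {r}. r < y" by (auto simp: le_less)
  qed
  then have np: "num_prop [Node r cs] = (if r = Min S then 1 else 0) + num_prop ?F"
    using nin by (auto simp: num_prop_def proper_vertices_Node finite_proper_vertices fl)
  note pw = prod_tree_weight[OF A F(1)]
  show ?thesis
  proof (cases "r = Min S")
    case True
    have "v ^ num_prop ?F = v ^ card A * v ^ (num_prop ?F - card A)"
      using pw(2) by (simp add: power_add[symmetric])
    then show ?thesis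
      unfolding tree_weight_def[of u v "Node r cs"] len np pw(1) using True by (simp add: mult_ac)
  next
    case False
    \<comment> \<open>\<open>Min S\<close> lies below the root, so there is a child and
      \<open>card A - 1\<close> is not truncated.\<close>
    then have "Min S \<in> S - {r}" using assms(1,2) by (auto intro: Min_in)
    then have "A \<noteq> {}" "finite A" using A by (auto simp: tree_sets_def)
    then have "0 < card A" by (simp add: card_gt_0_iff)
    then have "v ^ (num_prop ?F - 1) = v ^ (card A - 1) * v ^ (num_prop ?F - card A)"
      using pw(2) by (simp add: power_add[symmetric])
    moreover have "Suc (card (S - {r})) - num_prop ?F = Suc (card (S - {r}) - num_prop ?F)"
      using pw(3) by simp
    ultimately show ?thesis
      unfolding tree_weight_def[of u v "Node r cs"] len np pw(1) using False by (simp add: mult_ac)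
  qed
qed

lemma of_nat_card_color_orderings:
  assumes "finite A"
  shows "(of_nat (card (color_orderings 1 k A)) :: 'a::comm_ring_1) = rising 1 (of_nat k) (card A)"
  using card_color_orderings[OF assms, of 1 k] by (simp add: rising_def)

section \<open>Recursions for tree sums and forest sums\<close>

definition tree_sum :: "nat \<Rightarrow> 'a::comm_ring_1 \<Rightarrow> 'a \<Rightarrow> nat set \<Rightarrow> 'a" where
  "tree_sum k u v S = (\<Sum>T\<in>labeled_trees k S. tree_weight u v T)"

text \<open>For nonempty \<open>S\<close> this is the forest sum with its factor \<open>w\<close>
  removed, just as \<open>Q_poly\<close> is obtained from \<open>P_poly\<close>.\<close>

definition reduced_forest_sum :: "nat \<Rightarrow> 'a::comm_ring_1 \<Rightarrow> 'a \<Rightarrow> 'a \<Rightarrow> nat set \<Rightarrow> 'a" where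
  "reduced_forest_sum k u v w S =
     (\<Sum>A\<in>tree_sets k S. (\<Prod>T\<in>A. tree_weight u v T) * rising v (w + v) (card A - 1))"

lemma tree_sets_card_Suc:
  assumes "A \<in> tree_sets k S" "S \<noteq> {}"
  obtains m where "card A = Suc m"
  using assms by (cases "card A") (auto simp: tree_sets_def)

lemma forest_sum_eq_reduced:
  assumes "S \<noteq> {}"
  shows "forest_sum k u v w S = w * reduced_forest_sum k u v w S"
  unfolding forest_sum_def reduced_forest_sum_def sum_distrib_left
proof (rule sum.cong[OF refl])
  fix A assume "A \<in> tree_sets k S"
  then obtain m where "card A = Suc m" using assms by (rule tree_sets_card_Suc)
  then show "(\<Prod>T\<in>A. tree_weight u v T) * rising v w (card A) =
      w * ((\<Prod>T\<in>A. tree_weight u v T) * rising v (w + v) (card A - 1))"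
    by (simp add: rising_Suc_shift mult_ac)
qed

lemma forest_sum_empty [simp]: "forest_sum k u v w {} = 1"
proof -
  have "tree_sets k {} = {{}}" by (auto simp: tree_sets_def)
  then show ?thesis by (simp add: forest_sum_def)
qed

text \<open>Cutting at the root, \<open>rising 1 k m\<close> child lists arise from each set of
  \<open>m\<close> trees. With the root \<open>Min S\<close> the factor is
  \<open>v ^ m * rising 1 k m = rising v (k v) m\<close>; with any other root it is \<open>u * v ^
  (m - 1) * rising 1 k m = k u * rising v (k v + v) (m - 1)\<close>.\<close>

lemma tree_sum_rec:
  assumes "finite S" "S \<noteq> {}"
  shows "tree_sum k u v S = forest_sum k u v (of_nat k * v) (S - {Min S})
    + (\<Sum>r\<in>S - {Min S}. of_nat k * u * reduced_forest_sum k u v (of_nat k * v) (S - {r}))"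
proof -
  let ?c = "\<lambda>r A. if r = Min S then v ^ card A else u * v ^ (card A - 1)"
  let ?p = "\<lambda>A. \<Prod>T\<in>A. tree_weight u v T"
  have fin: "finite A" if "A \<in> tree_sets k X" for A X
    using that by (simp add: tree_sets_def)
  have disj: "color_orderings 1 k A \<inter> color_orderings 1 k B = {}" if "A \<noteq> B" for A B :: "ctree set"
    using that by (auto simp: color_orderings_def)
  have "tree_sum k u v S =
      (\<Sum>r\<in>S. \<Sum>T\<in>(\<Union>A\<in>tree_sets k (S - {r}). Node r ` color_orderings 1 k A). tree_weight u v T)"
    unfolding tree_sum_def labeled_trees_eq using assms(1) fin
    by (intro sum.UNION_disjoint) (auto simp: finite_tree_sets finite_color_orderings)
  also have "\<dots> = (\<Sum>r\<in>S. \<Sum>A\<in>tree_sets k (S - {r}). \<Sum>cs\<in>color_orderings 1 k A. tree_weight u v (Node r cs))"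
  proof (intro sum.cong refl)
    fix r
    have "(\<Sum>T\<in>(\<Union>A\<in>tree_sets k (S - {r}). Node r ` color_orderings 1 k A). tree_weight u v T)
        = (\<Sum>A\<in>tree_sets k (S - {r}). \<Sum>T\<in>Node r ` color_orderings 1 k A. tree_weight u v T)"
      using assms(1) fin disj
      by (intro sum.UNION_disjoint)
        (simp_all add: finite_tree_sets finite_color_orderings image_Int[symmetric] inj_on_def)
    then show "(\<Sum>T\<in>(\<Union>A\<in>tree_sets k (S - {r}). Node r ` color_orderings 1 k A). tree_weight u v T)
        = (\<Sum>A\<in>tree_sets k (S - {r}). \<Sum>cs\<in>color_orderings 1 k A. tree_weight u v (Node r cs))"
      by (simp add: sum.reindex inj_on_def)
  qed
  also have "\<dots> = (\<Sum>r\<in>S. \<Sum>A\<in>tree_sets k (S - {r}). rising 1 (of_nat k) (card A) * (?c r A * ?p A))"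
    using assms(1) fin
    by (intro sum.cong refl) (simp add: tree_weight_Node[OF assms(1)] of_nat_card_color_orderings[symmetric])
  also have "\<dots> = (\<Sum>A\<in>tree_sets k (S - {Min S}). rising 1 (of_nat k) (card A) * (v ^ card A * ?p A))
      + (\<Sum>r\<in>S - {Min S}. \<Sum>A\<in>tree_sets k (S - {r}). rising 1 (of_nat k) (card A) * (?c r A * ?p A))"
    using assms by (subst sum.remove[of S "Min S"]) auto
  also have "(\<Sum>A\<in>tree_sets k (S - {Min S}). rising 1 (of_nat k) (card A) * (v ^ card A * ?p A))
      = forest_sum k u v (of_nat k * v) (S - {Min S})"
    unfolding forest_sum_def rising_scale by (simp add: mult_ac)
  also have "(\<Sum>r\<in>S - {Min S}. \<Sum>A\<in>tree_sets k (S - {r}). rising 1 (of_nat k) (card A) * (?c r A * ?p A))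
      = (\<Sum>r\<in>S - {Min S}. of_nat k * u * reduced_forest_sum k u v (of_nat k * v) (S - {r}))"
    unfolding reduced_forest_sum_def sum_distrib_left
  proof (intro sum.cong refl)
    fix r A assume r: "r \<in> S - {Min S}" and A: "A \<in> tree_sets k (S - {r})"
    have "Min S \<in> S - {r}" using r assms by auto
    then obtain m where m: "card A = Suc m" using tree_sets_card_Suc[OF A] by blast
    have "rising v (of_nat k * v + v) m = v ^ m * rising 1 (of_nat k + 1) m"
      using rising_scale[of v "of_nat k + 1" m] by (simp add: algebra_simps)
    then show "rising 1 (of_nat k) (card A) * (?c r A * ?p A)
      = of_nat k * u * (?p A * rising v (of_nat k * v + v) (card A - 1))"
      using r by (simp add: m rising_Suc_shift mult_ac)
  qed
  finally show ?thesis .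
qed

text \<open>Exactly one tree \<open>T\<close> of \<open>A\<close> contains the label
  \<open>m\<close>. So \<open>A\<close> corresponds to the triple of the label set \<open>X\<close>
  of \<open>T\<close>, the tree \<open>T\<close> and the set \<open>B\<close> of the other
  trees.\<close>

lemma sum_tree_sets_rec:
  fixes h :: "ctree set \<Rightarrow> 'a::comm_ring_1"
  assumes "finite S" "m \<in> S"
  shows "(\<Sum>A\<in>tree_sets k S. h A) =
    (\<Sum>X\<in>insert m ` Pow (S - {m}). \<Sum>T\<in>labeled_trees k X. \<Sum>B\<in>tree_sets k (S - X). h (insert T B))"
proof -
  let ?I = "insert m ` Pow (S - {m})"
  let ?D = "SIGMA X:?I. SIGMA T:labeled_trees k X. tree_sets k (S - X)"
  let ?g = "\<lambda>(X, T, B). insert T B"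
  have I: "X \<in> ?I \<longleftrightarrow> m \<in> X \<and> X \<subseteq> S" for X
    using assms(2) by (auto intro!: image_eqI[of X _ "X - {m}"])
  \<comment> \<open>The label \<open>m\<close> singles out \<open>T\<close> within
    \<open>insert T B\<close>, which makes the map injective.\<close>
  have TB: "T \<notin> B" "m \<in> set (tree_labels T)" "\<forall>T'\<in>B. m \<notin> set (tree_labels T')"
    if "(X, T, B) \<in> ?D" for X T B
  proof -
    have "X \<in> ?I" "T \<in> labeled_trees k X" and B: "B \<in> tree_sets k (S - X)"
      using that by simp_all
    then have mX: "m \<in> X" and TX: "set (tree_labels T) = X"
      unfolding I by (simp_all add: labeled_trees_def)
    then show "m \<in> set (tree_labels T)" by simp
    show "T \<notin> B"
      using tree_sets_labels_subset[OF B, of T] label_in_tree_labels[of T] TX by auto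
    show "\<forall>T'\<in>B. m \<notin> set (tree_labels T')"
      using tree_sets_labels_subset[OF B] mX by blast
  qed
  have "inj_on ?g ?D"
  proof (rule inj_onI)
    fix p q assume pq: "p \<in> ?D" "q \<in> ?D" "?g p = ?g q"
    obtain X T B X' T' B' where p: "p = (X, T, B)" and q: "q = (X', T', B')"
      by (metis prod_cases3)
    have D: "(X, T, B) \<in> ?D" "(X', T', B') \<in> ?D" and eq: "insert T B = insert T' B'"
      using pq unfolding p q by simp_all
    have "T = T'" using TB[OF D(1)] TB[OF D(2)] eq by blast
    moreover have "B = insert T B - {T}" "B' = insert T' B' - {T'}"
      using TB(1)[OF D(1)] TB(1)[OF D(2)] by auto
    ultimately have "B = B'" using eq by metis
    with \<open>T = T'\<close> show "p = q" unfolding p q using D by (auto simp: labeled_trees_def)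
  qed
  moreover have "?g ` ?D = tree_sets k S"
  proof (intro equalityI subsetI)
    fix A assume "A \<in> ?g ` ?D"
    then obtain p where p: "p \<in> ?D" "A = ?g p" by (rule imageE)
    obtain X T B where "p = (X, T, B)" by (rule prod_cases3)
    with p have D: "(X, T, B) \<in> ?D" and A: "A = insert T B" by simp_all
    have X: "X \<subseteq> S" "colored_tree k T" "distinct (tree_labels T)" "set (tree_labels T) = X"
      and B: "B \<in> tree_sets k (S - X)"
      using D I[of X] by (simp_all add: labeled_trees_def)
    have disj: "set (tree_labels T) \<inter> set (tree_labels T') = {}" if "T' \<in> B" for T'
      using X B that by (auto simp: tree_sets_def)
    have "(\<Union>T\<in>A. set (tree_labels T)) = S"
      using X B by (auto simp: A tree_sets_def)
    then show "A \<in> tree_sets k S"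
      using X(2,3) B disj unfolding tree_sets_def A by (simp add: Int_commute)
  next
    fix A assume A: "A \<in> tree_sets k S"
    then obtain T where T: "T \<in> A" "m \<in> set (tree_labels T)"
      using assms(2) by (auto simp: tree_sets_def)
    let ?X = "set (tree_labels T)"
    have "?X \<in> ?I" unfolding I using A T by (auto simp: tree_sets_def)
    moreover have "T \<in> labeled_trees k ?X" using A T by (simp add: labeled_trees_def tree_sets_def)
    moreover have "(\<Union>T'\<in>A - {T}. set (tree_labels T')) = S - ?X"
    proof -
      have "S = (\<Union>T'\<in>A. set (tree_labels T'))" using A by (simp add: tree_sets_def)
      moreover have "set (tree_labels T') \<inter> ?X = {}" if "T' \<in> A - {T}" for T'
        using A T(1) that by (simp add: tree_sets_def)
      ultimately show ?thesis using T(1) by blast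
    qed
    then have "A - {T} \<in> tree_sets k (S - ?X)" using A by (simp add: tree_sets_def)
    ultimately have "(?X, T, A - {T}) \<in> ?D" by (intro SigmaI)
    moreover have "A = ?g (?X, T, A - {T})" using T by auto
    ultimately show "A \<in> ?g ` ?D" by (rule rev_image_eqI)
  qed
  ultimately have "bij_betw ?g ?D (tree_sets k S)" by (simp add: bij_betw_def)
  then have "(\<Sum>A\<in>tree_sets k S. h A) = (\<Sum>d\<in>?D. h (?g d))"
    by (rule sum.reindex_bij_betw[symmetric])
  also have "\<dots> = (\<Sum>X\<in>?I. \<Sum>(T, B)\<in>(SIGMA T:labeled_trees k X. tree_sets k (S - X)). h (insert T B))"
    using assms(1)
    by (subst sum.Sigma) (auto intro!: finite_SigmaI finite_labeled_trees finite_tree_sets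
        intro: finite_subset simp: case_prod_beta)
  also have "\<dots> = (\<Sum>X\<in>?I. \<Sum>T\<in>labeled_trees k X. \<Sum>B\<in>tree_sets k (S - X). h (insert T B))"
    using assms
    by (intro sum.cong refl sum.Sigma[symmetric] ballI finite_labeled_trees finite_tree_sets)
      (auto intro: finite_subset)
  finally show ?thesis .
qed

text \<open>Removing the tree that contains \<open>m\<close> lowers the number of trees by one, so
  \<open>rising v (w + v) (card A - 1)\<close> becomes the full rising product of the remaining
  trees at \<open>w + v\<close>.\<close>

lemma reduced_forest_sum_rec:
  assumes "finite S" "m \<in> S"
  shows "reduced_forest_sum k u v w S =
    (\<Sum>Y\<in>Pow (S - {m}). tree_sum k u v (insert m Y) * forest_sum k u v (w + v) (S - {m} - Y))"
proof -
  have "reduced_forest_sum k u v w S =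
    (\<Sum>X\<in>insert m ` Pow (S - {m}). tree_sum k u v X * forest_sum k u v (w + v) (S - X))"
    unfolding reduced_forest_sum_def sum_tree_sets_rec[OF assms] tree_sum_def forest_sum_def sum_product
  proof (intro sum.cong refl)
    fix X T B assume "X \<in> insert m ` Pow (S - {m})" "T \<in> labeled_trees k X" and B: "B \<in> tree_sets k (S - X)"
    then have "T \<notin> B" "finite B"
      using label_in_tree_labels[of T] tree_sets_labels_subset[OF B, of T]
      by (auto simp: labeled_trees_def tree_sets_def)
    then show "(\<Prod>T\<in>insert T B. tree_weight u v T) * rising v (w + v) (card (insert T B) - 1) =
       tree_weight u v T * ((\<Prod>T\<in>B. tree_weight u v T) * rising v (w + v) (card B))"
      by (simp add: mult_ac)
  qed
  also have "\<dots> = (\<Sum>Y\<in>Pow (S - {m}). tree_sum k u v (insert m Y) * forest_sum k u v (w + v) (S - insert m Y))"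
    by (subst sum.reindex) (auto simp: inj_on_def)
  also have "\<dots> = (\<Sum>Y\<in>Pow (S - {m}). tree_sum k u v (insert m Y) * forest_sum k u v (w + v) (S - {m} - Y))"
    by (intro sum.cong refl arg_cong2[where f = "(*)"] arg_cong[where f = "forest_sum k u v (w + v)"]) auto
  finally show ?thesis .
qed

text \<open>Strong induction on the number of labels. Tree sums on \<open>S\<close> come from forest
  sums with one label fewer. Reduced forest sums on \<open>S\<close> are then the convolution of the
  tree values at \<open>- v\<close> with the forest values at \<open>w + v\<close>, and these
  parameters add up to \<open>w\<close>.\<close>

lemma tree_and_forest_sums:
  fixes k :: nat and u v :: "'a::comm_ring_1"
  defines "a \<equiv> of_nat k * u" and "b \<equiv> of_nat (k + 1) * v"
  assumes "finite S" "card S = Suc n"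
  shows "tree_sum k u v S = Q_poly n a b (- v)" (is ?t)
    and "reduced_forest_sum k u v w S = Q_poly n a b w" (is ?r)
proof -
  have "?t \<and> (\<forall>w. reduced_forest_sum k u v w S = Q_poly n a b w)"
    using assms(3,4)
  proof (induction n arbitrary: S rule: less_induct)
    case (less n S)
    have forest: "forest_sum k u v w X = P_poly (card X) a b w"
      if X: "finite X" "card X \<le> n" for X w
    proof (cases "X = {}")
      case False
      then obtain j where "card X = Suc j" using X(1) by (cases "card X") auto
      then show ?thesis
        using less(1)[of j X] X False by (simp add: forest_sum_eq_reduced P_poly_Suc)
    qed simp
    have ne: "S \<noteq> {}" using less(3) by auto
    then have MinS: "Min S \<in> S" using less(2) by simp
    have cM: "card (S - {Min S}) = n" using MinS less(2,3) by simp
    have red: "reduced_forest_sum k u v (of_nat k * v) (S - {r}) = Q_poly (n - 1) a b (of_nat k * v)"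
      if "r \<in> S - {Min S}" for r
    proof -
      have "card (S - {r}) = n" using that less(2,3) by simp
      moreover have "0 < card (S - {r})"
        unfolding card_gt_0_iff using that MinS less(2) by blast
      ultimately show ?thesis using less(1)[of "n - 1" "S - {r}"] less(2) by simp
    qed
    have "tree_sum k u v S = P_poly n a b (of_nat k * v) + of_nat n * (a * Q_poly (n - 1) a b (of_nat k * v))"
      unfolding tree_sum_rec[OF less(2) ne] using red less(2) cM
      by (simp add: forest a_def)
    \<comment> \<open>The parameter \<open>- v\<close> arises here:
      \<open>- v + b = of_nat k * v\<close>, as \<open>Q_poly_eq\<close> requires.\<close>
    also have "\<dots> = Q_poly n a b (- v)"
      unfolding Q_poly_eq[of n a b "- v"] by (simp add: b_def algebra_simps)
    finally have tree: "tree_sum k u v S = Q_poly n a b (- v)" .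
    \<comment> \<open>A tree using all labels of \<open>S\<close> is not covered by the induction
      hypothesis, but by \<open>tree\<close>, which has just been shown.\<close>
    have trees: "tree_sum k u v (insert (Min S) Y) = Q_poly (card Y) a b (- v)"
      if "Y \<in> Pow (S - {Min S})" for Y
    proof -
      have Y: "Y \<subseteq> S - {Min S}" "finite Y" "Min S \<notin> Y"
        using that less(2) by (auto intro: finite_subset)
      show ?thesis
      proof (cases "Y = S - {Min S}")
        case True
        then show ?thesis using tree cM MinS by (simp add: insert_absorb)
      next
        case False
        then have "card Y < n"
          using Y less(2) cM psubset_card_mono[of "S - {Min S}" Y] by auto
        then show ?thesis using Y less(1)[of "card Y" "insert (Min S) Y"] by simp
      qed
    qed
    have "reduced_forest_sum k u v w S = Q_poly n a b w" for w
    proof -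
      have "reduced_forest_sum k u v w S = (\<Sum>Y\<in>Pow (S - {Min S}).
          Q_poly (card Y) a b (- v) * P_poly (n - card Y) a b (w + v))"
        unfolding reduced_forest_sum_rec[OF less(2) MinS]
      proof (intro sum.cong refl)
        fix Y assume Y: "Y \<in> Pow (S - {Min S})"
        then have "card (S - {Min S} - Y) = n - card Y"
          using less(2) cM by (subst card_Diff_subset) (auto intro: finite_subset)
        then show "tree_sum k u v (insert (Min S) Y) * forest_sum k u v (w + v) (S - {Min S} - Y)
          = Q_poly (card Y) a b (- v) * P_poly (n - card Y) a b (w + v)"
          using less(2) by (simp add: trees[OF Y] forest)
      qed
      also have "\<dots> = binomial_conv (\<lambda>j. Q_poly j a b (- v)) (\<lambda>j. P_poly j a b (w + v)) n"
        using sum_Pow_card[of "S - {Min S}" "\<lambda>j. Q_poly j a b (- v) * P_poly (n - j) a b (w + v)"] less(2)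
        unfolding cM by (simp add: binomial_conv_def mult.assoc)
      also have "\<dots> = Q_poly n a b w" by (simp add: binomial_conv_poly)
      finally show ?thesis .
    qed
    with tree show ?case by blast
  qed
  then show ?t ?r by blast+
qed

theorem theorem8p3:
  fixes k n :: nat and u v w :: "'a::comm_ring_1"
  assumes "k \<ge> 1"
  shows "(\<Sum>F \<in> colored_forests k n.
            u ^ (n - num_prop F) * v ^ (num_prop F - num_comp F) * w ^ num_comp F)
         = P_poly n (of_nat k * u) (of_nat (k + 1) * v) w"
proof (cases n)
  case 0
  then show ?thesis unfolding sum_colored_forests by simp
next
  case (Suc m)
  have "forest_sum k u v w {1..n} = w * reduced_forest_sum k u v w {1..n}"
    using Suc by (intro forest_sum_eq_reduced) simp
  then show ?thesis
    unfolding sum_colored_forests using tree_and_forest_sums(2)[of "{1..n}" m k u v w] Suc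
    by (simp add: P_poly_Suc)
qed

end
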